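(* Let $n\ge 2$ and let $$c_n = \frac{\sqrt{(n-2)^2 + 16(n-1)} - (n-2)}{8(n-1)}.$$ The following statements are true. (1) For a lattice $L \in \mathcal W^*_n$, $C(L) = 1/2$ if and only if $|S(L)| > 2n$. (2) Let $B = \{ b_1,\dots,b_n \}$ in $\mathbb R^n$ be a collection of linearly independent unit vectors such that $$\max_{1 \leq i < j \leq n} |(b_i,b_j)| \leq c_n.$$ Then $L = \mathrm{span}_{\mathbb Z} B$ is in $\mathcal W^*_n$.
   Context: A lattice $L$ means a lattice of rank $n\ge 2$ in $\mathbb R^n$. $\|\cdot\|$ is the Euclidean norm, $(\cdot,\cdot)$ the usual scalar product, $|L| = \min\{\|x\| : x\in L\setminus\{0\}\}$, and $S(L)=\{x\in L:\|x\|=|L|\}$ is the set of minimal vectors; $|S(L)|$ is its cardinality. The coherence of $L$ is $C(L)=\max\{|\cos \mathfrak a(x,y)| : x,y\in S(L),\ x\neq\pm y\}$, where $\mathfrak a(x,y)$ is the angle between $x$ and $y$. $L$ is well-rounded (WR) if $\mathrm{span}_{\mathbb R}S(L)=\mathrm{span}_{\mathbb R}L$. For an ordered basis $\{b_1,\dots,b_n\}$ of $L$, let $\theta_i\in(0,\pi/2]$ ($1\le i\le n-1$) be the angle between $b_{i+1}$ and the subspace $\mathrm{span}_{\mathbb R}\{b_1,\dots,b_i\}$. The ordered basis is weakly nearly orthogonal if $\theta_i\ge\pi/3$ for all $1\le i\le n-1$; a basis is nearly orthogonal if every ordering of it is weakly nearly orthogonal. Two lattices $L_1,L_2$ are similar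 if $L_2=\alpha U L_1$ with $\alpha>0$ and $U$ real orthogonal. $\mathcal W^*_n$ is the set of similarity classes of WR lattices in $\mathbb R^n$ that have a nearly orthogonal basis; each class is represented by a lattice with minimal norm $1$. *)

theory Defs
  imports "HOL-Analysis.Analysis"
begin

global_interpretation int_mod: module "\<lambda>(k::int) (x::'a::real_vector). of_int k *\<^sub>R x"
  defines int_span = int_mod.span
  by unfold_locales (simp_all add: algebra_simps)

definition lattice_basis :: "(real^'n) set \<Rightarrow> (real^'n) set \<Rightarrow> bool" where
  "lattice_basis B L \<longleftrightarrow> independent B \<and> card B = CARD('n) \<and> int_span B = L"

definition is_lattice :: "(real^'n) set \<Rightarrow> bool" where
  "is_lattice L \<longleftrightarrow> (\<exists>B. lattice_basis B L)"

text \<open>On a lattice the infimum is attained, so it is the minimum.\<close>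

definition min_norm :: "(real^'n) set \<Rightarrow> real" where
  "min_norm L = (INF x\<in>L - {0}. norm x)"

definition min_vectors :: "(real^'n) set \<Rightarrow> (real^'n) set" where
  "min_vectors L = {x \<in> L. norm x = min_norm L}"

definition vec_angle :: "real^'n \<Rightarrow> real^'n \<Rightarrow> real" where
  "vec_angle x y = arccos ((x \<bullet> y) / (norm x * norm y))"

definition coherence :: "(real^'n) set \<Rightarrow> real" where
  "coherence L = Max {\<bar>cos (vec_angle x y)\<bar> | x y.
     x \<in> min_vectors L \<and> y \<in> min_vectors L \<and> x \<noteq> y \<and> x \<noteq> - y}"

definition well_rounded :: "(real^'n) set \<Rightarrow> bool" where
  "well_rounded L \<longleftrightarrow> span (min_vectors L) = span L"

text \<open>The angle between a vector and a nonzero subspace is the least angle that the vector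
  makes with a nonzero vector of the subspace. It never exceeds \<open>pi / 2\<close>, because the
  subspace is closed under negation.\<close>

definition subspace_angle :: "real^'n \<Rightarrow> (real^'n) set \<Rightarrow> real" where
  "subspace_angle x V = (INF y\<in>V - {0}. vec_angle x y)"

text \<open>Positions are counted from 0: \<open>bs ! i\<close> is the vector \<open>b\<^sub>i\<^sub>+\<^sub>1\<close> and
  \<open>take i bs\<close> lists \<open>b\<^sub>1\<close> up to \<open>b\<^sub>i\<close>.\<close>

definition weakly_nearly_orthogonal :: "(real^'n) list \<Rightarrow> bool" where
  "weakly_nearly_orthogonal bs \<longleftrightarrow>
     (\<forall>i\<in>{1..<length bs}. subspace_angle (bs ! i) (span (set (take i bs))) \<ge> pi / 3)"

definition nearly_orthogonal :: "(real^'n) set \<Rightarrow> bool" where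
  "nearly_orthogonal B \<longleftrightarrow>
     (\<forall>bs. distinct bs \<and> set bs = B \<longrightarrow> weakly_nearly_orthogonal bs)"

definition similarity_rel :: "((real^'n) set \<times> (real^'n) set) set" where
  "similarity_rel = {(L1, L2). is_lattice L1 \<and> is_lattice L2 \<and>
     (\<exists>\<alpha>>0. \<exists>U. orthogonal_matrix U \<and> L2 = (\<lambda>x. \<alpha> *\<^sub>R (U *v x)) ` L1)}"

definition similarity_class :: "(real^'n) set \<Rightarrow> (real^'n) set set" where
  "similarity_class L = similarity_rel `` {L}"

text \<open>The elements of \<open>Wstar\<close> are similarity classes; a lattice \<open>L\<close> is said to
  belong to it when \<open>similarity_class L \<in> Wstar\<close>.\<close>

definition Wstar :: "(real^'n) set set set" where
  "Wstar = {L. is_lattice L \<and> well_rounded L \<and>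
     (\<exists>B. lattice_basis B L \<and> nearly_orthogonal B)} // similarity_rel"

definition coherence_bound :: "nat \<Rightarrow> real" where
  "coherence_bound n =
     (sqrt ((real n - 2)\<^sup>2 + 16 * (real n - 1)) - (real n - 2)) / (8 * (real n - 1))"

end

theory Submission
  imports Defs
begin

text \<open>A basis \<open>B\<close> is nearly orthogonal iff every \<open>b\<close> in \<open>B\<close> makes an angle of at least \<open>pi / 3\<close>
  with the span of the remaining basis vectors. If \<open>x = v + k b\<close> is a minimal vector with
  \<open>k \<noteq> 0\<close> and \<open>v\<close> in that span, then \<open>norm x\<close> is at least the minimum of \<open>norm v\<close> and
  \<open>norm (k b)\<close>, and equality forces \<open>\<bar>k\<bar> = 1\<close>, \<open>b\<close> minimal, and either \<open>v = 0\<close>, or \<open>v\<close> minimal at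
  angle \<open>pi / 3\<close> or \<open>2 pi / 3\<close> to \<open>b\<close>. So well-roundedness makes all basis vectors minimal, and
  a minimal vector outside \<open>\<plusminus>B\<close> yields a pair with cosine \<open>\<plusminus>1 / 2\<close>; conversely such a pair yields,
  by subtraction or addition, a minimal vector outside \<open>\<plusminus>B\<close>. For the second part, estimating
  \<open>\<bar>b \<bullet> y\<bar>\<close> from above and \<open>norm y\<close> from below by the coefficients of \<open>y\<close> reduces the angle
  condition to \<open>4 (n - 1) c\<^sup>2 + (n - 2) c \<le> 1\<close>, whose extremal solution is \<open>c\<^sub>n\<close>.\<close>

section \<open>Near orthogonality as an inequality between inner products\<close>

text \<open>Says that every \<open>b\<close> meets the span of the other vectors at an angle of at
  least \<open>pi / 3\<close>. The form with inner products avoids \<open>arccos\<close> and the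
  infimum, stays meaningful for \<open>y = 0\<close>, and needs no ordering of
  \<open>B\<close>.\<close>

definition angle_separated :: "'a::real_inner set \<Rightarrow> bool" where
  "angle_separated B \<longleftrightarrow> (\<forall>b\<in>B. \<forall>y\<in>span (B - {b}). \<bar>b \<bullet> y\<bar> \<le> norm b * norm y / 2)"

lemma angle_separatedD:
  assumes "angle_separated B" "b \<in> B" "y \<in> span (B - {b})"
  shows "\<bar>b \<bullet> y\<bar> \<le> norm b * norm y / 2"
  using assms by (auto simp: angle_separated_def)

lemma angle_separated_subset:
  assumes "angle_separated B" "A \<subseteq> B"
  shows "angle_separated A"
proof -
  have "span (A - {b}) \<subseteq> span (B - {b})" for b
    using assms(2) by (intro span_mono) auto
  then show ?thesis
    using assms unfolding angle_separated_def by blast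
qed

lemma abs_normalized_inner_le_1: "\<bar>(x \<bullet> y) / (norm x * norm y)\<bar> \<le> 1"
  using Cauchy_Schwarz_ineq2[of x y] by (auto simp: abs_mult divide_le_eq_1)

lemma cos_vec_angle: "cos (vec_angle x y) = (x \<bullet> y) / (norm x * norm y)"
  unfolding vec_angle_def using abs_normalized_inner_le_1[of x y] by (intro cos_arccos; linarith)

lemma vec_angle_bounds: "0 \<le> vec_angle x y" "vec_angle x y \<le> pi"
  unfolding vec_angle_def using abs_normalized_inner_le_1[of x y]
  by (intro arccos_lbound arccos_ubound; linarith)+

lemma vec_angle_ge_pi_third_iff:
  assumes "x \<noteq> 0" "y \<noteq> 0"
  shows "pi / 3 \<le> vec_angle x y \<longleftrightarrow> x \<bullet> y \<le> norm x * norm y / 2"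
proof -
  have "pi / 3 \<le> vec_angle x y \<longleftrightarrow> cos (vec_angle x y) \<le> cos (pi / 3)"
    using vec_angle_bounds[of x y] by (intro cos_mono_le_eq[symmetric]) auto
  then show ?thesis
    using assms by (simp add: cos_vec_angle cos_60 field_simps)
qed

text \<open>Cosine decreases on \<open>[0, pi]\<close>, so each angle bound is a one-sided bound on
  an inner product; closure of \<open>V\<close> under negation makes it two-sided. The condition
  \<open>V \<noteq> {0}\<close> keeps the infimum from ranging over the empty set.\<close>

lemma subspace_angle_ge_pi_third_iff:
  assumes "x \<noteq> 0" "subspace V" "V \<noteq> {0}"
  shows "pi / 3 \<le> subspace_angle x V \<longleftrightarrow> (\<forall>y\<in>V. \<bar>x \<bullet> y\<bar> \<le> norm x * norm y / 2)"
proof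
  assume le: "pi / 3 \<le> subspace_angle x V"
  have bdd: "bdd_below (vec_angle x ` (V - {0}))"
    using vec_angle_bounds by (intro bdd_belowI2[of _ 0]) auto
  have *: "x \<bullet> y \<le> norm x * norm y / 2" if "y \<in> V" for y
  proof (cases "y = 0")
    case False
    then have "subspace_angle x V \<le> vec_angle x y"
      unfolding subspace_angle_def using that by (intro cINF_lower bdd) auto
    then show ?thesis
      using le vec_angle_ge_pi_third_iff[OF \<open>x \<noteq> 0\<close> False] by linarith
  qed auto
  show "\<forall>y\<in>V. \<bar>x \<bullet> y\<bar> \<le> norm x * norm y / 2"
  proof
    fix y assume "y \<in> V"
    with *[of y] *[of "- y"] subspace_neg[OF assms(2)] show "\<bar>x \<bullet> y\<bar> \<le> norm x * norm y / 2"
      by auto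
  qed
next
  assume R: "\<forall>y\<in>V. \<bar>x \<bullet> y\<bar> \<le> norm x * norm y / 2"
  have "V - {0} \<noteq> {}"
    using assms subspace_0 by blast
  then show "pi / 3 \<le> subspace_angle x V"
    unfolding subspace_angle_def
  proof (rule cINF_greatest)
    fix y assume "y \<in> V - {0}"
    then show "pi / 3 \<le> vec_angle x y"
      using R vec_angle_ge_pi_third_iff[OF \<open>x \<noteq> 0\<close>, of y] by force
  qed
qed

text \<open>An ordering that ends in \<open>b\<close> has all of \<open>B - {b}\<close> before
  \<open>b\<close>, which gives one direction. Conversely, what precedes \<open>b\<close> in any
  ordering lies in \<open>B - {b}\<close>, so its span is contained in
  \<open>span (B - {b})\<close>.\<close>

lemma nearly_orthogonal_iff_angle_separated:
  assumes "independent B" "2 \<le> card B"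
  shows "nearly_orthogonal B \<longleftrightarrow> angle_separated B"
proof -
  have fin: "finite B"
    using assms(1) by (rule independent_imp_finite)
  have nz: "b \<noteq> 0" if "b \<in> B" for b
    using that assms(1) dependent_zero by blast
  have nz_span: "span A \<noteq> {0}" if "A \<subseteq> B" "A \<noteq> {}" for A
    using that nz span_superset[of A] by blast
  show ?thesis
  proof
    assume no: "nearly_orthogonal B"
    have "\<forall>y\<in>span (B - {b}). \<bar>b \<bullet> y\<bar> \<le> norm b * norm y / 2" if b: "b \<in> B" for b
    proof -
      obtain cs where cs: "set cs = B - {b}" "distinct cs"
        using finite_distinct_list[of "B - {b}"] fin by auto
      have len: "length cs = card B - 1"
        using cs b fin distinct_card[OF cs(2)] by simp
      have "distinct (cs @ [b])" "set (cs @ [b]) = B"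
        using cs b by auto
      then have "weakly_nearly_orthogonal (cs @ [b])"
        using no unfolding nearly_orthogonal_def by blast
      \<comment> \<open>The last index is at least 1, as the definition demands, because
        \<open>B\<close> has two elements or more.\<close>
      moreover have "length cs \<in> {1..<length (cs @ [b])}"
        using len assms(2) by auto
      ultimately have "pi / 3 \<le> subspace_angle ((cs @ [b]) ! length cs)
          (span (set (take (length cs) (cs @ [b]))))"
        unfolding weakly_nearly_orthogonal_def by blast
      then have "pi / 3 \<le> subspace_angle b (span (B - {b}))"
        by (simp add: cs)
      moreover have "B - {b} \<noteq> {}"
        using len assms(2) cs(1) by force
      ultimately show ?thesis
        using subspace_angle_ge_pi_third_iff[OF nz[OF b] subspace_span nz_span, of "B - {b}"]
        by blast
    qed
    then show "angle_separated B"
      by (auto simp: angle_separated_def)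
  next
    assume sep: "angle_separated B"
    show "nearly_orthogonal B"
      unfolding nearly_orthogonal_def weakly_nearly_orthogonal_def
    proof (intro allI impI ballI)
      fix bs i assume bs: "distinct bs \<and> set bs = B" and i: "i \<in> {1..<length bs}"
      have b: "bs ! i \<in> B"
        using bs i by auto
      have "bs ! i \<notin> set (take i bs)"
        using bs i by (auto simp: in_set_conv_nth nth_eq_iff_index_eq)
      then have sub: "set (take i bs) \<subseteq> B - {bs ! i}"
        using bs set_take_subset by fastforce
      have "set (take i bs) \<noteq> {}"
        using i by auto
      then have "span (set (take i bs)) \<noteq> {0}"
        using sub by (intro nz_span) auto
      moreover have "\<forall>y\<in>span (set (take i bs)).
          \<bar>bs ! i \<bullet> y\<bar> \<le> norm (bs ! i) * norm y / 2"
        using angle_separatedD[OF sep b] span_mono[OF sub] by blast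
      ultimately show "pi / 3 \<le> subspace_angle (bs ! i) (span (set (take i bs)))"
        using subspace_angle_ge_pi_third_iff[OF nz[OF b] subspace_span] by blast
    qed
  qed
qed

section \<open>Lower bounds for the norms of lattice vectors\<close>

text \<open>The quadratic form \<open>s\<^sup>2 - s t + t\<^sup>2\<close> bounds \<open>norm (v + k b)\<close> from below, where
  \<open>s = norm v\<close> and \<open>t = norm (k b)\<close>, when the angle between \<open>v\<close> and \<open>b\<close> is at least \<open>pi / 3\<close>.\<close>

lemma hexagonal_form_ge:
  fixes m s t :: real
  assumes "0 < m" "m \<le> s" "m \<le> t"
  shows "m\<^sup>2 \<le> s\<^sup>2 - s * t + t\<^sup>2"
    and "s\<^sup>2 - s * t + t\<^sup>2 \<le> m\<^sup>2 \<Longrightarrow> s = m \<and> t = m"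
proof -
  \<comment> \<open>All three summands on the right are nonnegative when \<open>m \<le> s\<close>
    and \<open>m \<le> t\<close>. In the equality case each of them vanishes, and the last two give
    \<open>s = m\<close> and \<open>t = m\<close>.\<close>
  have eq: "s\<^sup>2 - s * t + t\<^sup>2 - m\<^sup>2 = (s - t)\<^sup>2 + m * (s - m) + s * (t - m)"
    by (simp add: power2_eq_square algebra_simps)
  have nonneg: "0 \<le> (s - t)\<^sup>2" "0 \<le> m * (s - m)" "0 \<le> s * (t - m)"
    using assms by simp_all
  show "m\<^sup>2 \<le> s\<^sup>2 - s * t + t\<^sup>2"
    using eq nonneg by linarith
  assume "s\<^sup>2 - s * t + t\<^sup>2 \<le> m\<^sup>2"
  then have "m * (s - m) = 0" "s * (t - m) = 0"
    using eq nonneg by linarith+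
  then show "s = m \<and> t = m"
    using assms by auto
qed

lemma norm_add_separated_ge:
  fixes v w :: "'a::real_inner"
  assumes "\<bar>w \<bullet> v\<bar> \<le> norm w * norm v / 2"
  shows "(norm v)\<^sup>2 - norm v * norm w + (norm w)\<^sup>2 \<le> (norm (w + v))\<^sup>2"
proof -
  have "(norm (w + v))\<^sup>2 = (norm w)\<^sup>2 + 2 * (w \<bullet> v) + (norm v)\<^sup>2"
    by (simp add: power2_norm_eq_inner inner_simps inner_commute)
  then show ?thesis
    using assms by (simp add: mult.commute)
qed

lemma abs_inner_scaleR_le_half:
  fixes b v :: "'a::real_inner"
  assumes "\<bar>b \<bullet> v\<bar> \<le> norm b * norm v / 2"
  shows "\<bar>(k *\<^sub>R b) \<bullet> v\<bar> \<le> norm (k *\<^sub>R b) * norm v / 2"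
  using mult_left_mono[OF assms, of "\<bar>k\<bar>"] by (simp add: abs_mult)

lemma norm_int_scaleR_ge:
  fixes b :: "'a::real_normed_vector"
  assumes "m \<le> norm b" "k \<noteq> 0"
  shows "m \<le> norm (of_int k *\<^sub>R b)"
proof -
  have "1 * norm b \<le> \<bar>of_int k\<bar> * norm b"
    using assms(2) by (intro mult_right_mono) (linarith, simp)
  then show ?thesis
    using assms(1) by simp
qed

text \<open>Induction that splits off one summand \<open>w\<close> from the rest \<open>v\<close>.
  If one of them is zero, the other alone is bounded; if neither is, both norms are at least
  \<open>m\<close> and the hexagonal form is at least \<open>m\<^sup>2\<close>.\<close>

lemma norm_int_combination_ge:
  fixes B :: "'a::real_inner set" and a :: "'a \<Rightarrow> int"
  assumes "finite B" "angle_separated B" "\<And>b. b \<in> B \<Longrightarrow> m \<le> norm b" "0 < m"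
    and "(\<Sum>b\<in>B. of_int (a b) *\<^sub>R b) \<noteq> 0"
  shows "m \<le> norm (\<Sum>b\<in>B. of_int (a b) *\<^sub>R b)"
  using assms
proof (induction B rule: finite_induct)
  case (insert b B)
  define v where "v = (\<Sum>c\<in>B. of_int (a c) *\<^sub>R c)"
  define w where "w = of_int (a b) *\<^sub>R b"
  have sum_eq: "(\<Sum>c\<in>insert b B. of_int (a c) *\<^sub>R c) = w + v"
    using insert by (simp add: v_def w_def)
  have IH: "m \<le> norm v" if "v \<noteq> 0"
    using insert that angle_separated_subset[OF insert.prems(1)] unfolding v_def by blast
  have wm: "m \<le> norm w" if "a b \<noteq> 0"
    unfolding w_def using insert.prems(2) that by (intro norm_int_scaleR_ge) auto
  have "v \<in> span (insert b B - {b})"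
    unfolding v_def using insert.hyps by (intro span_sum span_scale span_base) auto
  then have wv: "\<bar>w \<bullet> v\<bar> \<le> norm w * norm v / 2"
    unfolding w_def using angle_separatedD[OF insert.prems(1)] by (intro abs_inner_scaleR_le_half) auto
  consider "a b = 0" | "v = 0" "a b \<noteq> 0" | "a b \<noteq> 0" "v \<noteq> 0"
    by blast
  then have "m \<le> norm (w + v)"
  proof cases
    case 1
    then show ?thesis
      using IH insert.prems(4) sum_eq by (simp add: w_def)
  next
    case 2
    then show ?thesis
      using wm by simp
  next
    case 3
    have "m\<^sup>2 \<le> (norm (w + v))\<^sup>2"
      using hexagonal_form_ge(1)[OF \<open>0 < m\<close> IH wm] 3 norm_add_separated_ge[OF wv] by linarith
    then show ?thesis
      by (rule power2_le_imp_le) simp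
  qed
  then show ?case
    by (simp add: sum_eq)
qed simp

lemma int_span_finite:
  assumes "finite B"
  shows "int_span B = range (\<lambda>a :: 'a::real_vector \<Rightarrow> int. \<Sum>b\<in>B. of_int (a b) *\<^sub>R b)"
  by (rule int_mod.span_finite[OF assms])

lemma int_span_subset_span: "int_span B \<subseteq> span B"
  by (rule int_mod.span_minimal)
     (auto simp: int_mod.subspace_def span_zero span_add span_scale span_base)

lemma norm_int_span_ge:
  fixes B :: "'a::real_inner set"
  assumes "finite B" "angle_separated B" "\<And>b. b \<in> B \<Longrightarrow> m \<le> norm b" "0 < m"
    and "x \<in> int_span B" "x \<noteq> 0"
  shows "m \<le> norm x"
proof -
  obtain a where a: "x = (\<Sum>b\<in>B. of_int (a b) *\<^sub>R b)"
    using assms(5) unfolding int_span_finite[OF assms(1)] by blast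
  show ?thesis
    unfolding a by (rule norm_int_combination_ge) (use assms a in auto)
qed

text \<open>No nonzero lattice vector is shorter than the shortest element of \<open>B\<close>, so
  the infimum is attained in \<open>B\<close> itself.\<close>

lemma min_norm_int_span:
  assumes "finite B" "B \<noteq> {}" "0 \<notin> B" "angle_separated B"
  shows "min_norm (int_span B) = Min (norm ` B)"
proof -
  have "Min (norm ` B) \<in> norm ` B"
    using assms by (intro Min_in) auto
  then obtain c where c: "c \<in> B" "norm c = Min (norm ` B)"
    by auto
  have pos: "0 < Min (norm ` B)"
    using c assms(3) by (metis zero_less_norm_iff)
  show ?thesis
    unfolding min_norm_def
  proof (rule cInf_eq_minimum)
    show "Min (norm ` B) \<in> norm ` (int_span B - {0})"
      using c assms(3) by (intro image_eqI[of _ _ c]) (auto intro: int_mod.span_base)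
    show "Min (norm ` B) \<le> y" if "y \<in> norm ` (int_span B - {0})" for y
      using that norm_int_span_ge[OF assms(1,4) _ pos] assms(1) by auto
  qed
qed

section \<open>Minimal vectors in coordinates, and well-roundedness\<close>

text \<open>The equality case of \<open>norm_int_combination_ge\<close>: with \<open>w\<close> the
  summand at \<open>c\<close>, equality in the hexagonal form forces
  \<open>norm v = norm w = m\<close> unless \<open>v = 0\<close>. As \<open>norm c\<close> lies
  between \<open>m\<close> and \<open>norm w\<close>, the coefficient has absolute value 1.\<close>

lemma minimal_combination:
  fixes B :: "'a::real_inner set" and a :: "'a \<Rightarrow> int"
  assumes "finite B" "angle_separated B" "\<And>b. b \<in> B \<Longrightarrow> m \<le> norm b" "0 < m"
    and x: "norm (\<Sum>b\<in>B. of_int (a b) *\<^sub>R b) = m" and c: "c \<in> B" "a c \<noteq> 0"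
  defines "v \<equiv> \<Sum>b\<in>B - {c}. of_int (a b) *\<^sub>R b"
  shows "norm c = m" "\<bar>a c\<bar> = 1" "v \<noteq> 0 \<Longrightarrow> norm v = m \<and> \<bar>c \<bullet> v\<bar> = m\<^sup>2 / 2"
proof -
  define w where "w = of_int (a c) *\<^sub>R c"
  have sum_eq: "(\<Sum>b\<in>B. of_int (a b) *\<^sub>R b) = w + v"
    unfolding v_def w_def using assms(1) c(1) by (rule sum.remove)
  have wm: "m \<le> norm w"
    using norm_int_scaleR_ge[OF assms(3)[OF c(1)] c(2)] by (simp add: w_def)
  have v_span: "v \<in> span (B - {c})"
    unfolding v_def by (intro span_sum span_scale span_base)
  then have wv: "\<bar>w \<bullet> v\<bar> \<le> norm w * norm v / 2"
    unfolding w_def using angle_separatedD[OF assms(2) c(1)] by (intro abs_inner_scaleR_le_half) auto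
  have vm: "m \<le> norm v" if "v \<noteq> 0"
    unfolding v_def
  proof (rule norm_int_combination_ge)
    show "angle_separated (B - {c})"
      using assms(2) by (rule angle_separated_subset) auto
  qed (use assms that in auto)
  have equal: "norm v = m \<and> norm w = m" if "v \<noteq> 0"
    using hexagonal_form_ge(2)[OF \<open>0 < m\<close> vm wm] that norm_add_separated_ge[OF wv] x sum_eq by simp
  have w: "norm w = m"
    using equal x sum_eq by (cases "v = 0") auto
  then have *: "\<bar>of_int (a c)\<bar> * norm c = m"
    by (simp add: w_def)
  have "norm c \<le> m"
    using norm_int_scaleR_ge[OF order_refl c(2), of c] w by (simp add: w_def)
  then show cm: "norm c = m"
    using assms(3)[OF c(1)] by simp
  then show ac: "\<bar>a c\<bar> = 1"
    using * \<open>0 < m\<close> by (simp flip: of_int_abs)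
  assume "v \<noteq> 0"
  then have v: "norm v = m"
    using equal by blast
  \<comment> \<open>Since \<open>w\<close>, \<open>v\<close> and \<open>w + v\<close> all have norm
    \<open>m\<close>, expanding the square determines the inner product.\<close>
  have "(norm (w + v))\<^sup>2 = (norm w)\<^sup>2 + 2 * (w \<bullet> v) + (norm v)\<^sup>2"
    by (simp add: power2_norm_eq_inner inner_simps inner_commute)
  then have "m\<^sup>2 = m\<^sup>2 + 2 * (w \<bullet> v) + m\<^sup>2"
    using x v w by (simp add: sum_eq)
  then have "w \<bullet> v = - (m\<^sup>2 / 2)"
    by simp
  then have "\<bar>w \<bullet> v\<bar> = m\<^sup>2 / 2"
    by simp
  moreover have "\<bar>w \<bullet> v\<bar> = \<bar>c \<bullet> v\<bar>"
    using ac unfolding w_def by (simp add: abs_mult flip: of_int_abs)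
  ultimately show "norm v = m \<and> \<bar>c \<bullet> v\<bar> = m\<^sup>2 / 2"
    using v by simp
qed

text \<open>If \<open>b\<close> were longer than the minimum, every minimal vector would have
  coefficient 0 at \<open>b\<close>. All of them would then lie in \<open>span (B - {b})\<close>,
  which misses \<open>b\<close> by independence.\<close>

lemma well_rounded_norm_eq:
  assumes "independent B" "angle_separated B" "well_rounded (int_span B)" "b \<in> B"
  shows "norm b = min_norm (int_span B)"
proof (rule ccontr)
  assume ne: "norm b \<noteq> min_norm (int_span B)"
  define m where "m = min_norm (int_span B)"
  have fin: "finite B"
    using assms(1) by (rule independent_imp_finite)
  have nz: "0 \<notin> B"
    using assms(1) dependent_zero by blast
  have m: "m = Min (norm ` B)"
    using min_norm_int_span[OF fin _ nz assms(2)] assms(4) by (auto simp: m_def)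
  then have "m \<in> norm ` B"
    using fin assms(4) by (auto intro!: Min_in)
  then have pos: "0 < m"
    using nz by auto
  have "min_vectors (int_span B) \<subseteq> span (B - {b})"
  proof
    fix x assume "x \<in> min_vectors (int_span B)"
    then obtain a where a: "x = (\<Sum>b\<in>B. of_int (a b) *\<^sub>R b)" and "norm x = m"
      using fin by (auto simp: min_vectors_def int_span_finite m_def)
    then have "a b = 0"
      using minimal_combination(1)[OF fin assms(2) _ pos, of a b] ne m fin assms(4)
      by (auto simp: m_def)
    then have "x = (\<Sum>b\<in>B - {b}. of_int (a b) *\<^sub>R b)"
      unfolding a using fin assms(4) by (simp add: sum.remove)
    then show "x \<in> span (B - {b})"
      by (simp only:) (intro span_sum span_scale span_base)
  qed
  then have "span (min_vectors (int_span B)) \<subseteq> span (B - {b})"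
    by (simp add: span_minimal)
  moreover have "b \<in> span (int_span B)"
    using assms(4) by (intro span_base int_mod.span_base)
  ultimately have "b \<in> span (B - {b})"
    using assms(3) by (auto simp: well_rounded_def)
  then show False
    using assms(1,4) by (auto simp: dependent_def)
qed

section \<open>Coherence and minimal vectors for a separated basis of equal norms\<close>

text \<open>The common norm \<open>r\<close> is arbitrary because a similarity rescales the basis of
  a representative; unit vectors are the case \<open>r = 1\<close>.\<close>

locale equinorm_separated_basis =
  fixes B :: "(real^'n) set" and r :: real
  assumes indep: "independent B" and sep: "angle_separated B" and card2: "2 \<le> card B"
    and norm_eq: "b \<in> B \<Longrightarrow> norm b = r"
begin

lemma fin: "finite B"
  using indep by (rule independent_imp_finite)

lemma zero_notin: "0 \<notin> B"
  using indep dependent_zero by blast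

lemma not_in_span: "b \<in> B \<Longrightarrow> b \<notin> span (B - {b})"
  using indep by (auto simp: dependent_def)

lemma r_pos: "0 < r"
proof -
  have "B \<noteq> {}"
    using card2 by auto
  then obtain b where "b \<in> B"
    by blast
  then show ?thesis
    using norm_eq[of b] zero_notin by auto
qed

lemma min_norm_eq: "min_norm (int_span B) = r"
proof -
  have "B \<noteq> {}"
    using card2 by auto
  moreover from this have "norm ` B = {r}"
    using norm_eq by auto
  ultimately show ?thesis
    using min_norm_int_span[OF fin _ zero_notin sep] by simp
qed

abbreviation M where "M \<equiv> min_vectors (int_span B)"

lemma mem_M: "x \<in> M \<longleftrightarrow> x \<in> int_span B \<and> norm x = r"
  by (simp add: min_vectors_def min_norm_eq)

lemma basis_subset_M: "B \<subseteq> M"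
  using norm_eq by (auto simp: mem_M intro: int_mod.span_base)

lemma uminus_mem_M: "x \<in> M \<Longrightarrow> - x \<in> M"
  using int_mod.span_neg[of x B] by (simp add: mem_M)

lemma M_combinationE:
  assumes "x \<in> M"
  obtains a :: "real^'n \<Rightarrow> int" where "x = (\<Sum>b\<in>B. of_int (a b) *\<^sub>R b)" "norm x = r"
proof -
  have "x \<in> int_span B" "norm x = r"
    using assms by (auto simp: mem_M)
  then show thesis
    using that unfolding int_span_finite[OF fin] by blast
qed

lemma span_M: "span M = span (int_span B)"
proof
  show "span M \<subseteq> span (int_span B)"
    by (intro span_mono) (auto simp: mem_M)
  have "span B \<subseteq> span M"
    by (intro span_mono basis_subset_M)
  then show "span (int_span B) \<subseteq> span M"
    using int_span_subset_span[of B] by (intro span_minimal) auto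
qed

text \<open>Coefficients of a minimal vector are -1, 0 or 1, which leaves finitely many choices.
  Finiteness gives sense to \<open>Max\<close> in the coherence and to comparing
  cardinalities.\<close>

lemma finite_M: "finite M"
proof (rule finite_subset)
  show "M \<subseteq> (\<lambda>a :: real^'n \<Rightarrow> int. \<Sum>b\<in>B. of_int (a b) *\<^sub>R b) ` (B \<rightarrow>\<^sub>E {-1, 0, 1})"
  proof
    fix x assume "x \<in> M"
    then obtain a where a: "x = (\<Sum>b\<in>B. of_int (a b) *\<^sub>R b)" "norm x = r"
      by (rule M_combinationE)
    have "a b \<in> {-1, 0, 1}" if "b \<in> B" for b
      using minimal_combination(2)[OF fin sep _ r_pos, of a b] a that norm_eq by force
    \<comment> \<open>Restricting to \<open>B\<close> places the coefficient function in the finite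
      extensional function space without changing the sum.\<close>
    then have "restrict a B \<in> B \<rightarrow>\<^sub>E {-1, 0, 1}"
      by auto
    moreover have "x = (\<Sum>b\<in>B. of_int (restrict a B b) *\<^sub>R b)"
      by (simp add: a)
    ultimately show "x \<in> (\<lambda>a :: real^'n \<Rightarrow> int. \<Sum>b\<in>B. of_int (a b) *\<^sub>R b) ` (B \<rightarrow>\<^sub>E {-1, 0, 1})"
      by blast
  qed
  show "finite ((\<lambda>a :: real^'n \<Rightarrow> int. \<Sum>b\<in>B. of_int (a b) *\<^sub>R b) ` (B \<rightarrow>\<^sub>E {-1, 0, 1}))"
    using fin by (intro finite_imageI finite_PiE) auto
qed

lemma signed_basis_subset: "B \<union> uminus ` B \<subseteq> M"
  using basis_subset_M uminus_mem_M by auto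

lemma card_signed_basis: "card (B \<union> uminus ` B) = 2 * card B"
proof -
  have "- b \<notin> B" if "b \<in> B" for b
  proof
    assume "- b \<in> B"
    moreover have "- b \<noteq> b"
    proof
      assume "- b = b"
      then have "2 *\<^sub>R b = 0"
        by (simp add: scaleR_2 eq_neg_iff_add_eq_0)
      then show False
        using that zero_notin by auto
    qed
    ultimately have "- (- b) \<in> span (B - {b})"
      by (intro span_neg span_base) auto
    then show False
      using not_in_span[OF that] by simp
  qed
  then have "B \<inter> uminus ` B = {}"
    by auto
  then show ?thesis
    using fin by (simp add: card_Un_disjoint card_image)
qed

text \<open>Let \<open>y\<close> be \<open>b\<close> or \<open>- b\<close>. If \<open>x - y\<close>
  were a signed basis vector, comparing norms would show it differs from \<open>y\<close> and
  \<open>- y\<close>; then \<open>x\<close> and \<open>x - y\<close>, hence also \<open>y\<close>,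
  would lie in \<open>span (B - {b})\<close>.\<close>

lemma diff_notin_signed_basis:
  assumes "x \<in> B \<union> uminus ` B" "y \<in> B \<union> uminus ` B" "x \<noteq> y" "x \<noteq> - y"
  shows "x - y \<notin> B \<union> uminus ` B"
proof
  assume z: "x - y \<in> B \<union> uminus ` B"
  have norms: "norm x = r" "norm y = r" "norm (x - y) = r"
    using assms z signed_basis_subset mem_M by blast+
  obtain b where b: "b \<in> B" "y = b \<or> y = - b"
    using assms(2) by auto
  have ne: "x - y \<noteq> y" "x - y \<noteq> - y"
  proof -
    show "x - y \<noteq> y"
    proof
      assume "x - y = y"
      then have "x = 2 *\<^sub>R y"
        by (simp add: scaleR_2 algebra_simps)
      then show False
        using norms r_pos by simp
    qed
    show "x - y \<noteq> - y"
      using norms r_pos by auto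
  qed
  have in_span: "u \<in> span (B - {b})" if "u \<in> B \<union> uminus ` B" "u \<noteq> y" "u \<noteq> - y" for u
  proof -
    have "u \<in> B - {b} \<or> - u \<in> B - {b}"
      using that b by auto
    then show ?thesis
      using span_base[of u] span_neg[OF span_base, of "- u"] by auto
  qed
  have "x - (x - y) \<in> span (B - {b})"
    by (intro span_diff in_span assms(1,3,4) z ne)
  then have "b \<in> span (B - {b})"
    using b(2) span_neg[of "- b" "B - {b}"] by auto
  then show False
    using not_in_span[OF b(1)] by simp
qed

text \<open>Both \<open>x - y\<close> and \<open>x + y\<close> are nonzero lattice vectors, so their
  norms are at least \<open>r\<close>; expanding the squares bounds the inner product from both
  sides.\<close>

lemma abs_inner_le:
  assumes "x \<in> M" "y \<in> M" "x \<noteq> y" "x \<noteq> - y"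
  shows "\<bar>x \<bullet> y\<bar> \<le> r\<^sup>2 / 2"
proof -
  have *: "x \<bullet> y \<le> r\<^sup>2 / 2" if "x \<in> M" "y \<in> M" "x \<noteq> y" for x y
  proof -
    have "r \<le> norm (x - y)"
    proof (rule norm_int_span_ge[OF fin sep _ r_pos])
      show "x - y \<in> int_span B"
        using that by (intro int_mod.span_diff) (auto simp: mem_M)
    qed (use that norm_eq in auto)
    then have "r\<^sup>2 \<le> (norm (x - y))\<^sup>2"
      using r_pos by (intro power_mono) auto
    also have "\<dots> = (norm x)\<^sup>2 - 2 * (x \<bullet> y) + (norm y)\<^sup>2"
      by (simp add: power2_norm_eq_inner inner_simps inner_commute)
    finally show ?thesis
      using that by (simp add: mem_M)
  qed
  have "- y \<in> M"
    using assms(2) by (rule uminus_mem_M)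
  then show ?thesis
    using *[of x y] *[of x "- y"] assms by auto
qed

lemma abs_inner_eq_iff:
  "(\<exists>x\<in>M. \<exists>y\<in>M. x \<noteq> y \<and> x \<noteq> - y \<and> \<bar>x \<bullet> y\<bar> = r\<^sup>2 / 2) \<longleftrightarrow> M \<noteq> B \<union> uminus ` B"
proof
  assume "\<exists>x\<in>M. \<exists>y\<in>M. x \<noteq> y \<and> x \<noteq> - y \<and> \<bar>x \<bullet> y\<bar> = r\<^sup>2 / 2"
  \<comment> \<open>Replacing \<open>y\<close> by \<open>- y\<close>, again a minimal vector, makes
    the inner product positive.\<close>
  then obtain x y where xy: "x \<in> M" "y \<in> M" "x \<noteq> y" "x \<noteq> - y" "x \<bullet> y = r\<^sup>2 / 2"
  proof -
    assume *: thesis if "x \<in> M" "y \<in> M" "x \<noteq> y" "x \<noteq> - y" "x \<bullet> y = r\<^sup>2 / 2" for x y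
    from \<open>\<exists>x\<in>M. _\<close> obtain x y
      where xy: "x \<in> M" "y \<in> M" "x \<noteq> y" "x \<noteq> - y" "\<bar>x \<bullet> y\<bar> = r\<^sup>2 / 2"
      by blast
    moreover have "- y \<in> M"
      using xy(2) by (rule uminus_mem_M)
    ultimately show thesis
      using *[of x y] *[of x "- y"] by (auto simp: abs_if split: if_splits)
  qed
  have "(norm (x - y))\<^sup>2 = (norm x)\<^sup>2 - 2 * (x \<bullet> y) + (norm y)\<^sup>2"
    by (simp add: power2_norm_eq_inner inner_simps inner_commute)
  also have "\<dots> = r\<^sup>2"
    using xy by (simp add: mem_M)
  finally have "norm (x - y) = r"
    using r_pos by (simp add: power2_eq_iff_nonneg)
  then have "x - y \<in> M"
    using xy by (auto simp: mem_M intro: int_mod.span_diff)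
  \<comment> \<open>If \<open>M\<close> were the signed basis,
    \<open>diff_notin_signed_basis\<close> would keep \<open>x - y\<close> out of it.\<close>
  then show "M \<noteq> B \<union> uminus ` B"
    using diff_notin_signed_basis xy by metis
next
  assume "M \<noteq> B \<union> uminus ` B"
  then obtain x where x: "x \<in> M" "x \<notin> B \<union> uminus ` B"
    using signed_basis_subset by blast
  obtain a where a: "x = (\<Sum>b\<in>B. of_int (a b) *\<^sub>R b)" "norm x = r"
    using x(1) by (rule M_combinationE)
  have "\<exists>c\<in>B. a c \<noteq> 0"
  proof (rule ccontr)
    assume "\<not> (\<exists>c\<in>B. a c \<noteq> 0)"
    then show False
      using a r_pos by simp
  qed
  then obtain c where c: "c \<in> B" "a c \<noteq> 0"
    by blast
  define v where "v = (\<Sum>b\<in>B - {c}. of_int (a b) *\<^sub>R b)"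
  have x_eq: "x = of_int (a c) *\<^sub>R c + v"
    unfolding v_def a using fin c(1) by (rule sum.remove)
  note mc = minimal_combination[OF fin sep _ r_pos, of a c, folded a(1) v_def]
  have "\<bar>a c\<bar> = 1"
    using mc(2) a c norm_eq by simp
  then have "a c = 1 \<or> a c = - 1"
    by linarith
  \<comment> \<open>Otherwise \<open>x\<close> would be \<open>c\<close> or \<open>- c\<close>. The
    pair sought is then \<open>c\<close> and \<open>v\<close>.\<close>
  then have "v \<noteq> 0"
    using x(2) c(1) by (auto simp: x_eq)
  then have v: "norm v = r" "\<bar>c \<bullet> v\<bar> = r\<^sup>2 / 2"
    using mc(3) a c norm_eq by auto
  have "v \<in> int_span B"
    unfolding v_def by (intro int_mod.span_sum int_mod.span_scale int_mod.span_base) auto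
  then have "v \<in> M"
    using v by (simp add: mem_M)
  have v_span: "v \<in> span (B - {c})"
    unfolding v_def by (intro span_sum span_scale span_base)
  then have "c \<noteq> v" "c \<noteq> - v"
    using not_in_span[OF c(1)] span_neg by blast+
  moreover have "c \<in> M"
    using c(1) signed_basis_subset by blast
  ultimately show "\<exists>x\<in>M. \<exists>y\<in>M. x \<noteq> y \<and> x \<noteq> - y \<and> \<bar>x \<bullet> y\<bar> = r\<^sup>2 / 2"
    using \<open>v \<in> M\<close> v(2) by blast
qed

lemma coherence_eq_half_iff: "coherence (int_span B) = 1 / 2 \<longleftrightarrow> 2 * card B < card M"
proof -
  define C where "C = {\<bar>cos (vec_angle x y)\<bar> | x y. x \<in> M \<and> y \<in> M \<and> x \<noteq> y \<and> x \<noteq> - y}"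
  have coh: "coherence (int_span B) = Max C"
    by (simp add: coherence_def C_def)
  have cos_eq: "\<bar>cos (vec_angle x y)\<bar> = \<bar>x \<bullet> y\<bar> / r\<^sup>2" if "x \<in> M" "y \<in> M" for x y
    using that by (simp add: cos_vec_angle mem_M power2_eq_square)
  have "C \<subseteq> (\<lambda>(x, y). \<bar>cos (vec_angle x y)\<bar>) ` (M \<times> M)"
    by (auto simp: C_def)
  then have finC: "finite C"
    using finite_M by (meson finite_SigmaI finite_imageI finite_subset)
  \<comment> \<open>Two basis vectors, different up to sign by independence, show that the maximum
    is over a nonempty set.\<close>
  obtain b c where bc: "b \<in> B" "c \<in> B" "b \<noteq> c"
    using card2 card_le_Suc0_iff_eq[OF fin] by force
  have "b \<noteq> - c"
  proof
    assume "b = - c"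
    then have "b \<in> span (B - {b})"
      using bc span_neg[OF span_base, of c "B - {b}"] by auto
    then show False
      using not_in_span bc by blast
  qed
  then have neC: "C \<noteq> {}"
    using bc signed_basis_subset unfolding C_def by blast
  have le: "t \<le> 1 / 2" if "t \<in> C" for t
    using that abs_inner_le r_pos by (auto simp: C_def cos_eq divide_le_eq)
  \<comment> \<open>Every element of \<open>C\<close> is at most \<open>1 / 2\<close>, so the
    maximum equals \<open>1 / 2\<close> exactly when this value occurs.\<close>
  have "Max C = 1 / 2 \<longleftrightarrow> 1 / 2 \<in> C"
    unfolding Max_eq_iff[OF finC neC] using le by blast
  also have "\<dots> \<longleftrightarrow> (\<exists>x\<in>M. \<exists>y\<in>M. x \<noteq> y \<and> x \<noteq> - y \<and> \<bar>x \<bullet> y\<bar> / r\<^sup>2 = 1 / 2)"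
  proof
    assume "1 / 2 \<in> C"
    then obtain x y where "x \<in> M" "y \<in> M" "x \<noteq> y" "x \<noteq> - y" "1 / 2 = \<bar>cos (vec_angle x y)\<bar>"
      unfolding C_def by blast
    then show "\<exists>x\<in>M. \<exists>y\<in>M. x \<noteq> y \<and> x \<noteq> - y \<and> \<bar>x \<bullet> y\<bar> / r\<^sup>2 = 1 / 2"
      using cos_eq by metis
  next
    assume "\<exists>x\<in>M. \<exists>y\<in>M. x \<noteq> y \<and> x \<noteq> - y \<and> \<bar>x \<bullet> y\<bar> / r\<^sup>2 = 1 / 2"
    then obtain x y where xy: "x \<in> M" "y \<in> M" "x \<noteq> y" "x \<noteq> - y" "\<bar>x \<bullet> y\<bar> / r\<^sup>2 = 1 / 2"
      by blast
    then have "\<bar>cos (vec_angle x y)\<bar> = 1 / 2"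
      by (simp only: cos_eq)
    then show "1 / 2 \<in> C"
      unfolding C_def using xy by (intro CollectI exI[of _ x] exI[of _ y]) simp
  qed
  also have "\<dots> \<longleftrightarrow> (\<exists>x\<in>M. \<exists>y\<in>M. x \<noteq> y \<and> x \<noteq> - y \<and> \<bar>x \<bullet> y\<bar> = r\<^sup>2 / 2)"
    using r_pos by (simp add: divide_eq_eq)
  also have "\<dots> \<longleftrightarrow> M \<noteq> B \<union> uminus ` B"
    by (rule abs_inner_eq_iff)
  \<comment> \<open>The signed basis is a subset of the finite set \<open>M\<close> with
    \<open>2 * card B\<close> elements; it is proper exactly when \<open>M\<close> is
    larger.\<close>
  also have "\<dots> \<longleftrightarrow> 2 * card B < card M"
    using psubset_card_mono[OF finite_M, of "B \<union> uminus ` B"] signed_basis_subset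
    by (auto simp flip: card_signed_basis)
  finally show ?thesis
    by (simp add: coh)
qed

end

section \<open>Transport along similarities\<close>

lemma int_span_linear_image:
  fixes g :: "'a::real_vector \<Rightarrow> 'b::real_vector"
  assumes "linear g"
  shows "int_span (g ` B) = g ` int_span B"
proof -
  interpret g: module_hom "\<lambda>(k::int) x. of_int k *\<^sub>R x" "\<lambda>(k::int) x. of_int k *\<^sub>R x" g
    by unfold_locales (simp_all add: assms linear_add linear_cmul)
  show ?thesis
    using g.span_image[of B] by (simp add: int_span_def)
qed

lemma norm_similarity:
  fixes g :: "'a::real_inner \<Rightarrow> 'b::real_inner"
  assumes "\<And>x y. g x \<bullet> g y = k\<^sup>2 * (x \<bullet> y)" "0 < k"
  shows "norm (g x) = k * norm x"
  using assms by (simp add: norm_eq_sqrt_inner real_sqrt_mult)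

text \<open>Both sides of the inequality scale by \<open>k\<^sup>2\<close>, and injectivity makes
  removing \<open>g b\<close> from the image match removing \<open>b\<close> from
  \<open>B\<close>.\<close>

lemma angle_separated_similarity:
  fixes g :: "'a::real_inner \<Rightarrow> 'b::real_inner"
  assumes "linear g" "inj g" "\<And>x y. g x \<bullet> g y = k\<^sup>2 * (x \<bullet> y)" "0 < k" "angle_separated B"
  shows "angle_separated (g ` B)"
  unfolding angle_separated_def
proof (intro ballI)
  fix c z assume "c \<in> g ` B" "z \<in> span (g ` B - {c})"
  then obtain b where b: "b \<in> B" "c = g b"
    by auto
  have "g ` B - {c} = g ` (B - {b})"
    using assms(2) b by (auto simp: inj_eq)
  then obtain y where y: "y \<in> span (B - {b})" "z = g y"
    using \<open>z \<in> _\<close> by (auto simp: linear_span_image[OF assms(1)])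
  have "\<bar>b \<bullet> y\<bar> \<le> norm b * norm y / 2"
    by (rule angle_separatedD[OF assms(5) b(1) y(1)])
  then have "k\<^sup>2 * \<bar>b \<bullet> y\<bar> \<le> k\<^sup>2 * (norm b * norm y / 2)"
    by (intro mult_left_mono) auto
  then show "\<bar>c \<bullet> z\<bar> \<le> norm c * norm z / 2"
    using b y assms norm_similarity[of g k] by (simp add: abs_mult power2_eq_square ac_simps)
qed

text \<open>Membership of the class only provides some well-rounded representative \<open>L'\<close>
  with a nearly orthogonal basis. That basis has equal norms, and the similarity from
  \<open>L'\<close> to \<open>L\<close> carries it over.\<close>

lemma Wstar_imp_equinorm_separated_basis:
  fixes L :: "(real^'n::finite) set"
  assumes "2 \<le> CARD('n)" "is_lattice L" "similarity_class L \<in> Wstar"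
  obtains B r where "equinorm_separated_basis B r" "card B = CARD('n)" "int_span B = L"
proof -
  obtain L' B' where L': "is_lattice L'" "well_rounded L'" "lattice_basis B' L'" "nearly_orthogonal B'"
    and cls: "similarity_class L = similarity_rel `` {L'}"
    using assms(3) by (auto simp: Wstar_def elim!: quotientE)
  \<comment> \<open>Reflexivity puts \<open>L\<close> into its own class, which is also the class of
    \<open>L'\<close>.\<close>
  have "(L, L) \<in> similarity_rel"
    unfolding similarity_rel_def using assms(2)
    by (auto intro!: exI[of _ 1] exI[of _ "mat 1"] simp: orthogonal_matrix_id)
  then have "(L', L) \<in> similarity_rel"
    using cls by (auto simp: similarity_class_def)
  then obtain \<alpha> U where U: "0 < \<alpha>" "orthogonal_matrix U" "L = (\<lambda>x. \<alpha> *\<^sub>R (U *v x)) ` L'"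
    by (auto simp: similarity_rel_def)
  define g where "g = (\<lambda>x. \<alpha> *\<^sub>R (U *v x))"
  have "orthogonal_transformation ((*v) U)"
    using U(2) by (simp add: orthogonal_transformation_matrix)
  then have inner_g: "g x \<bullet> g y = \<alpha>\<^sup>2 * (x \<bullet> y)" for x y
    by (simp add: g_def orthogonal_transformation_def power2_eq_square)
  have lin: "linear g"
    unfolding g_def by (intro linear_compose_scale_right) simp
  have norm_g: "norm (g x) = \<alpha> * norm x" for x
    using norm_similarity[of g \<alpha>] inner_g U(1) by simp
  have inj: "inj g"
    unfolding linear_injective_0[OF lin]
  proof (intro allI impI)
    fix x assume "g x = 0"
    then show "x = 0"
      using norm_g[of x] U(1) by simp
  qed
  have B': "independent B'" "card B' = CARD('n)" "int_span B' = L'"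
    using L'(3) by (auto simp: lattice_basis_def)
  have sep': "angle_separated B'"
    using L'(4) nearly_orthogonal_iff_angle_separated[OF B'(1)] B'(2) assms(1) by simp
  have "norm b = min_norm L'" if "b \<in> B'" for b
    using well_rounded_norm_eq[OF B'(1) sep' _ that] L'(2) B'(3) by simp
  moreover have card: "card (g ` B') = CARD('n)"
    using B'(2) inj by (simp add: card_image inj_on_subset[OF inj])
  moreover have "independent (g ` B')"
    using linear_independent_injective_image[OF lin B'(1)] inj inj_on_subset by blast
  ultimately have "equinorm_separated_basis (g ` B') (\<alpha> * min_norm L')"
    using angle_separated_similarity[OF lin inj inner_g U(1) sep'] assms(1)
    by unfold_locales (auto simp: norm_g)
  moreover have "int_span (g ` B') = L"
    using int_span_linear_image[OF lin] B'(3) U(3) by (simp add: g_def)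
  ultimately show thesis
    using that card by blast
qed

section \<open>The coherence bound and its sufficiency\<close>

text \<open>The quadratic formula: \<open>coherence_bound n\<close> is the nonnegative root of
  \<open>4 (n - 1) c\<^sup>2 + (n - 2) c = 1\<close>.\<close>

lemma coherence_bound_root:
  assumes "2 \<le> n"
  shows "4 * (real n - 1) * (coherence_bound n)\<^sup>2 = 1 - (real n - 2) * coherence_bound n"
    and "0 \<le> coherence_bound n"
proof -
  define m where "m = real n - 1"
  define s where "s = sqrt ((m - 1)\<^sup>2 + 16 * m)"
  have m: "1 \<le> m"
    using assms by (simp add: m_def)
  have c: "coherence_bound n = (s - (m - 1)) / (8 * m)"
    by (simp add: coherence_bound_def s_def m_def)
  have s2: "s\<^sup>2 = (m - 1)\<^sup>2 + 16 * m"
    using m by (simp add: s_def)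
  have "8 * m * coherence_bound n = s - (m - 1)"
    using m by (simp add: c)
  \<comment> \<open>This is the quadratic equation multiplied by \<open>16 * m\<close>, with the
    square completed.\<close>
  then have "(8 * m * coherence_bound n + (m - 1))\<^sup>2 = (m - 1)\<^sup>2 + 16 * m"
    using s2 by simp
  then have "16 * m * (4 * m * (coherence_bound n)\<^sup>2 + (m - 1) * coherence_bound n) = 16 * m * 1"
    by (simp add: power2_eq_square algebra_simps)
  then show "4 * (real n - 1) * (coherence_bound n)\<^sup>2 = 1 - (real n - 2) * coherence_bound n"
    using m unfolding mult_cancel_left by (simp add: m_def)
  have "m - 1 \<le> s"
    unfolding s_def using m by (intro real_le_rsqrt) simp
  then show "0 \<le> coherence_bound n"
    using m by (simp add: c)
qed

text \<open>Comparison of Gram matrices entry by entry: off the diagonal the worst contribution is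
  \<open>- \<mu> * \<bar>a b * a c\<bar>\<close>. The square of the full sum also subtracts
  \<open>\<mu>\<close> on the diagonal, which the factor \<open>1 + \<mu>\<close> restores.\<close>

lemma power2_norm_combination_ge:
  fixes A :: "'a::real_inner set" and a :: "'a \<Rightarrow> real"
  assumes "finite A" "\<And>b. b \<in> A \<Longrightarrow> norm b = 1"
    and "\<And>b c. b \<in> A \<Longrightarrow> c \<in> A \<Longrightarrow> b \<noteq> c \<Longrightarrow> \<bar>b \<bullet> c\<bar> \<le> \<mu>"
  shows "(1 + \<mu>) * (\<Sum>b\<in>A. (a b)\<^sup>2) - \<mu> * (\<Sum>b\<in>A. \<bar>a b\<bar>)\<^sup>2 \<le> (norm (\<Sum>b\<in>A. a b *\<^sub>R b))\<^sup>2"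
proof -
  have "(\<Sum>b\<in>A. \<Sum>c\<in>A. (if b = c then (1 + \<mu>) * (a b)\<^sup>2 else 0) - \<mu> * (\<bar>a b\<bar> * \<bar>a c\<bar>))
      \<le> (\<Sum>b\<in>A. \<Sum>c\<in>A. a b * a c * (b \<bullet> c))"
  proof (intro sum_mono)
    fix b c assume "b \<in> A" "c \<in> A"
    show "(if b = c then (1 + \<mu>) * (a b)\<^sup>2 else 0) - \<mu> * (\<bar>a b\<bar> * \<bar>a c\<bar>) \<le> a b * a c * (b \<bullet> c)"
    proof (cases "b = c")
      case True
      then have "b \<bullet> c = 1"
        using assms(2)[OF \<open>b \<in> A\<close>] by (simp add: dot_square_norm)
      then show ?thesis
        using True by (simp add: power2_eq_square algebra_simps)
    next
      case False
      then have "\<bar>b \<bullet> c\<bar> * \<bar>a b * a c\<bar> \<le> \<mu> * \<bar>a b * a c\<bar>"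
        using assms(3) \<open>b \<in> A\<close> \<open>c \<in> A\<close> by (intro mult_right_mono) auto
      moreover have "- (\<bar>b \<bullet> c\<bar> * \<bar>a b * a c\<bar>) \<le> a b * a c * (b \<bullet> c)"
        using abs_ge_minus_self[of "a b * a c * (b \<bullet> c)"] by (simp add: abs_mult ac_simps)
      ultimately show ?thesis
        using False by (simp add: abs_mult)
    qed
  qed
  also have "(\<Sum>b\<in>A. \<Sum>c\<in>A. a b * a c * (b \<bullet> c)) = (norm (\<Sum>b\<in>A. a b *\<^sub>R b))\<^sup>2"
    by (simp add: power2_norm_eq_inner inner_sum_left inner_sum_right sum_distrib_left ac_simps inner_commute)
  also have "(\<Sum>b\<in>A. \<Sum>c\<in>A. (if b = c then (1 + \<mu>) * (a b)\<^sup>2 else 0) - \<mu> * (\<bar>a b\<bar> * \<bar>a c\<bar>))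
      = (1 + \<mu>) * (\<Sum>b\<in>A. (a b)\<^sup>2) - \<mu> * (\<Sum>b\<in>A. \<bar>a b\<bar>)\<^sup>2"
    using assms(1)
    by (simp add: sum_subtractf sum.delta' power2_eq_square sum_product flip: sum_distrib_left)
  finally show ?thesis .
qed

text \<open>The sum \<open>T\<close> of absolute coefficients links the two estimates
  \<open>\<bar>b \<bullet> y\<bar> \<le> \<mu> * T\<close> and
  \<open>2 * (\<mu> * T) \<le> norm y\<close>.\<close>

lemma angle_separated_if_coherent:
  fixes B :: "'a::real_inner set"
  assumes "finite B" "2 \<le> card B" "\<And>b. b \<in> B \<Longrightarrow> norm b = 1"
    and coh: "\<And>b c. b \<in> B \<Longrightarrow> c \<in> B \<Longrightarrow> b \<noteq> c \<Longrightarrow> \<bar>b \<bullet> c\<bar> \<le> coherence_bound (card B)"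
  shows "angle_separated B"
  unfolding angle_separated_def
proof (intro ballI)
  fix b y assume b: "b \<in> B" and "y \<in> span (B - {b})"
  then obtain a where y: "y = (\<Sum>c\<in>B - {b}. a c *\<^sub>R c)"
    using assms(1) by (auto simp: span_finite)
  define \<mu> where "\<mu> = coherence_bound (card B)"
  define m where "m = real (card B) - 1"
  define T where "T = (\<Sum>c\<in>B - {b}. \<bar>a c\<bar>)"
  define Q where "Q = (\<Sum>c\<in>B - {b}. (a c)\<^sup>2)"
  have m: "1 \<le> m" "m = real (card (B - {b}))"
    using assms(1,2) b by (auto simp: m_def of_nat_diff)
  have root: "4 * m * \<mu>\<^sup>2 = 1 - (m - 1) * \<mu>" "0 \<le> \<mu>"
    using coherence_bound_root[OF assms(2)] by (auto simp: \<mu>_def m_def)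
  \<comment> \<open>Cauchy-Schwarz over the \<open>m\<close> vectors other than
    \<open>b\<close>.\<close>
  have "T\<^sup>2 \<le> Q * m"
    using sum_squared_le_sum_of_squares[of "\<lambda>c. \<bar>a c\<bar>" "B - {b}"] by (simp add: T_def Q_def m)
  then have "(1 + \<mu>) * T\<^sup>2 \<le> (1 + \<mu>) * (Q * m)"
    using root(2) by (intro mult_left_mono) auto
  moreover have "(1 + \<mu>) * Q - \<mu> * T\<^sup>2 \<le> (norm y)\<^sup>2"
    unfolding Q_def T_def y using assms by (intro power2_norm_combination_ge) (auto simp: \<mu>_def)
  then have "m * ((1 + \<mu>) * Q - \<mu> * T\<^sup>2) \<le> m * (norm y)\<^sup>2"
    using m(1) by (intro mult_left_mono) auto
  \<comment> \<open>Eliminating \<open>Q\<close> leaves \<open>(1 + \<mu> - m * \<mu>) * T\<^sup>2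
    \<le> m * (norm y)\<^sup>2\<close>, and the root equation identifies the factor as
    \<open>4 * m * \<mu>\<^sup>2\<close>.\<close>
  moreover have "4 * m * \<mu>\<^sup>2 * T\<^sup>2 = (1 - (m - 1) * \<mu>) * T\<^sup>2"
    by (simp only: root)
  ultimately have "m * (4 * \<mu>\<^sup>2 * T\<^sup>2) \<le> m * (norm y)\<^sup>2"
    by (simp add: algebra_simps)
  then have "(2 * (\<mu> * T))\<^sup>2 \<le> (norm y)\<^sup>2"
    using m(1) by (simp add: power_mult_distrib)
  then have "2 * (\<mu> * T) \<le> norm y"
    by (rule power2_le_imp_le) simp
  moreover have "\<bar>b \<bullet> y\<bar> \<le> \<mu> * T"
  proof -
    have "\<bar>b \<bullet> y\<bar> \<le> (\<Sum>c\<in>B - {b}. \<bar>a c * (b \<bullet> c)\<bar>)"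
      unfolding y inner_sum_right by (simp add: sum_abs)
    also have "\<dots> \<le> (\<Sum>c\<in>B - {b}. \<bar>a c\<bar> * \<mu>)"
      using coh b by (intro sum_mono) (auto simp: abs_mult \<mu>_def intro!: mult_left_mono)
    finally show ?thesis
      by (simp add: T_def sum_distrib_left mult.commute)
  qed
  ultimately show "\<bar>b \<bullet> y\<bar> \<le> norm b * norm y / 2"
    using assms(3)[OF b] by simp
qed

section \<open>Passage from similarity classes and indexed unit vectors to separated bases\<close>

theorem theorem1p6:
  assumes "CARD('n::finite) \<ge> 2"
  shows "(\<forall>L :: (real^'n) set. is_lattice L \<and> similarity_class L \<in> Wstar \<longrightarrow>
            (coherence L = 1 / 2 \<longleftrightarrow> card (min_vectors L) > 2 * CARD('n)))
       \<and> (\<forall>b :: nat \<Rightarrow> real^'n.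
            inj_on b {1..CARD('n)} \<and> independent (b ` {1..CARD('n)}) \<and>
            (\<forall>i\<in>{1..CARD('n)}. norm (b i) = 1) \<and>
            Max {\<bar>b i \<bullet> b j\<bar> | i j. 1 \<le> i \<and> i < j \<and> j \<le> CARD('n)}
              \<le> coherence_bound CARD('n) \<longrightarrow>
            is_lattice (int_span (b ` {1..CARD('n)})) \<and>
            similarity_class (int_span (b ` {1..CARD('n)})) \<in> Wstar \<and>
            min_norm (int_span (b ` {1..CARD('n)})) = 1)"
proof (intro conjI allI impI; elim conjE)
  fix L :: "(real^'n) set"
  assume "is_lattice L" "similarity_class L \<in> Wstar"
  then obtain B r where B: "equinorm_separated_basis B r" "card B = CARD('n)" "int_span B = L"
    using Wstar_imp_equinorm_separated_basis[OF assms] by metis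
  then show "coherence L = 1 / 2 \<longleftrightarrow> card (min_vectors L) > 2 * CARD('n)"
    using equinorm_separated_basis.coherence_eq_half_iff[OF B(1)] by simp
next
  fix b :: "nat \<Rightarrow> real^'n"
  assume inj: "inj_on b {1..CARD('n)}" and indep: "independent (b ` {1..CARD('n)})"
    and unit: "\<forall>i\<in>{1..CARD('n)}. norm (b i) = 1"
    and max: "Max {\<bar>b i \<bullet> b j\<bar> | i j. 1 \<le> i \<and> i < j \<and> j \<le> CARD('n)} \<le> coherence_bound CARD('n)"
  define B where "B = b ` {1..CARD('n)}"
  define L where "L = int_span B"
  have card: "card B = CARD('n)"
    using inj by (simp add: B_def card_image)
  have "{\<bar>b i \<bullet> b j\<bar> | i j. 1 \<le> i \<and> i < j \<and> j \<le> CARD('n)}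
      \<subseteq> (\<lambda>(i, j). \<bar>b i \<bullet> b j\<bar>) ` ({1..CARD('n)} \<times> {1..CARD('n)})"
    by force
  then have "finite {\<bar>b i \<bullet> b j\<bar> | i j. 1 \<le> i \<and> i < j \<and> j \<le> CARD('n)}"
    by (rule finite_subset) simp
  from Max_ge[OF this] max have less: "\<bar>b i \<bullet> b j\<bar> \<le> coherence_bound CARD('n)"
    if "1 \<le> i" "i < j" "j \<le> CARD('n)" for i j
    using that by (blast intro: order_trans)
  \<comment> \<open>The maximum ranges over index pairs with \<open>i < j\<close>; symmetry of the
    inner product covers the other order.\<close>
  have coh: "\<bar>x \<bullet> y\<bar> \<le> coherence_bound (card B)" if xy: "x \<in> B" "y \<in> B" "x \<noteq> y" for x y
  proof -
    obtain i j where "x = b i" "y = b j" "i \<in> {1..CARD('n)}" "j \<in> {1..CARD('n)}" "i \<noteq> j"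
      using xy unfolding B_def by (metis imageE)
    then show ?thesis
      using less[of i j] less[of j i] by (cases "i < j") (auto simp: card inner_commute)
  qed
  have sep: "angle_separated B"
    using assms coh card unit by (intro angle_separated_if_coherent) (auto simp: B_def)
  \<comment> \<open>With common norm 1 the lattice has minimal norm 1, so it is itself a normalized
    representative of its class.\<close>
  interpret equinorm_separated_basis B 1
    using indep sep card assms unit by unfold_locales (auto simp: B_def)
  have basis: "lattice_basis B L"
    using indep card by (simp add: lattice_basis_def L_def)
  then have lattice: "is_lattice L"
    by (auto simp: is_lattice_def)
  have "well_rounded L"
    using span_M by (simp add: well_rounded_def L_def)
  moreover have "nearly_orthogonal B"
    using nearly_orthogonal_iff_angle_separated[OF local.indep card2] sep by simp
  ultimately have "similarity_class L \<in> Wstar"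
    unfolding Wstar_def similarity_class_def using basis lattice by (intro quotientI) auto
  then show "is_lattice (int_span (b ` {1..CARD('n)}))"
    "similarity_class (int_span (b ` {1..CARD('n)})) \<in> Wstar"
    "min_norm (int_span (b ` {1..CARD('n)})) = 1"
    using lattice min_norm_eq by (simp_all add: L_def B_def)
qed

end
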